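(* Let $\mathcal{C}\subseteq\mathbb{N}^p$ be an affine integer cone, $\preceq$ a total order on $\mathbb{N}^p$, and $f\in\mathcal{C}\setminus\{0\}$. Then the directed graph $G(\mathfrak{B}(Fb=f))$ is a tree with root $(\mathcal{C}\setminus\mathcal{B}(f))\cup\{0\}$ (that is, every vertex is connected to the root by a unique path). Furthermore, for any $T\in\mathfrak{B}(Fb=f)$, the set of children of $T$ is $$\{T\cup\{x\}\mid x\in SG(T)\text{ and }x\prec\alpha(T)\}.$$
   Context: $\mathbb{N}$ contains $0$. An affine integer cone $\mathcal{C}\subseteq\mathbb{N}^p$ is a set $L(A)\cap\mathbb{N}^p$ with $A\subseteq\mathcal{C}$ finite and non-empty, where $L(A)$ is the set of non-negative real linear combinations of elements of $A$. A $\mathcal{C}$-semigroup is a submonoid $S\subseteq\mathcal{C}$ (containing $0$) with $\mathcal{H}(S)=\mathcal{C}\setminus S$ finite. A total order on $\mathbb{N}^p$ means a total order relation compatible with addition and satisfying $0\preceq x$ for all $x$. For $S\ne\mathcal{C}$, $\mathrm{Fb}(S)=\max_\preceq\mathcal{H}(S)$. Write $x\leq_{\mathcal{C}}y$ if $y-x\in\mathcal{C}$, and $\mathcal{B}(f)=\{x\in\mathcal{C}\mid x\leq_{\mathcal{C}}f\}$. $\mathfrak{B}(Fb=f)$ is the set of $\mathcal{B}$-semigroups with Frobenius element $f$, i.e. the $\mathcal{C}$-semigroups $S$ with $\mathrm{Fb}(S)=f$ and $S=S\cup(\mathcal{C}\setminus\mathcal{B}(f))$. For $S\in\mathfrak{B}(Fb=f)$,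 $\alpha(S)=\min_\preceq\big((S\setminus\{0\})\cap\mathcal{B}(f)\big)$, and $\alpha(S)=f$ if $S\cap\mathcal{B}(f)=\{0\}$. The set of special gaps of a $\mathcal{C}$-semigroup $S$ is $SG(S)=\{x\in\mathcal{H}(S)\mid x+(S\setminus\{0\})\subset S\text{ and }2x\in S\}$. The graph $G(\mathfrak{B}(Fb=f))$ has vertex set $\mathfrak{B}(Fb=f)$, and a pair $(S,T)$ of distinct vertices is an edge if and only if $T=S\setminus\{\alpha(S)\}$; in this case $S$ is called a child of $T$. A path from $S$ to $T$ is a sequence of distinct edges $(S_0,S_1),(S_1,S_2),\ldots,(S_{n-1},S_n)$ with $S_0=S$, $S_n=T$ (possibly empty if $S=T$). *)

theory Defs
  imports
    "HOL-Analysis.Finite_Cartesian_Product"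
    "Graph_Theory.Pair_Digraph"
begin

text \<open>Elements of \<open>\<nat>\<^sup>p\<close> are rendered as \<open>nat ^ 'p\<close>, with \<open>p = CARD('p)\<close>.\<close>

definition real_vec :: "nat ^ 'p \<Rightarrow> real ^ 'p" where
  "real_vec x = (\<chi> i. real (x $ i))"

definition nonneg_real_span :: "(nat ^ 'p) set \<Rightarrow> (real ^ 'p) set" where
  "nonneg_real_span A = {(\<Sum>a\<in>A. c a *\<^sub>R real_vec a) | c. \<forall>a\<in>A. (0::real) \<le> c a}"

definition affine_integer_cone :: "(nat ^ 'p) set \<Rightarrow> bool" where
  "affine_integer_cone C \<longleftrightarrow>
     (\<exists>A. finite A \<and> A \<noteq> {} \<and> A \<subseteq> C \<and> C = {x. real_vec x \<in> nonneg_real_span A})"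

definition additive_total_order :: "(nat ^ 'p \<Rightarrow> nat ^ 'p \<Rightarrow> bool) \<Rightarrow> bool" where
  "additive_total_order le \<longleftrightarrow>
     reflp le \<and> antisymp le \<and> transp le \<and> totalp le \<and>
     (\<forall>x y z. le x y \<longrightarrow> le (x + z) (y + z)) \<and> (\<forall>x. le 0 x)"

text \<open>
  Maximum and minimum with respect to an explicitly given order relation. They are
  meaningful only if the extremal element exists; for the relations and the finite
  non-empty sets to which they are applied below it does, and it is unique.
\<close>

definition max_wrt :: "('a \<Rightarrow> 'a \<Rightarrow> bool) \<Rightarrow> 'a set \<Rightarrow> 'a" where
  "max_wrt le X = (THE m. m \<in> X \<and> (\<forall>x\<in>X. le x m))"

definition min_wrt :: "('a \<Rightarrow> 'a \<Rightarrow> bool) \<Rightarrow> 'a set \<Rightarrow> 'a" where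
  "min_wrt le X = (THE m. m \<in> X \<and> (\<forall>x\<in>X. le m x))"

definition gaps :: "(nat ^ 'p) set \<Rightarrow> (nat ^ 'p) set \<Rightarrow> (nat ^ 'p) set" where
  "gaps C S = C - S"

definition C_semigroup :: "(nat ^ 'p) set \<Rightarrow> (nat ^ 'p) set \<Rightarrow> bool" where
  "C_semigroup C S \<longleftrightarrow>
     S \<subseteq> C \<and> 0 \<in> S \<and> (\<forall>x\<in>S. \<forall>y\<in>S. x + y \<in> S) \<and> finite (gaps C S)"

definition Frob ::
  "(nat ^ 'p) set \<Rightarrow> (nat ^ 'p \<Rightarrow> nat ^ 'p \<Rightarrow> bool) \<Rightarrow> (nat ^ 'p) set \<Rightarrow> nat ^ 'p" where
  "Frob C le S = max_wrt le (gaps C S)"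

text \<open>
  The difference \<open>y - x\<close> is that of \<open>\<int>\<^sup>p\<close>; to avoid truncated subtraction,
  \<open>y - x \<in> C\<close> is expressed by \<open>y = x + c\<close> with \<open>c \<in> C\<close>.
\<close>

definition cone_le :: "(nat ^ 'p) set \<Rightarrow> nat ^ 'p \<Rightarrow> nat ^ 'p \<Rightarrow> bool" where
  "cone_le C x y \<longleftrightarrow> (\<exists>c\<in>C. y = x + c)"

definition cone_box :: "(nat ^ 'p) set \<Rightarrow> nat ^ 'p \<Rightarrow> (nat ^ 'p) set" where
  "cone_box C f = {x \<in> C. cone_le C x f}"

text \<open>
  The conjunct \<open>S \<noteq> C\<close> is required for the Frobenius element of \<open>S\<close> to be defined.
\<close>

definition B_semigroups ::
  "(nat ^ 'p) set \<Rightarrow> (nat ^ 'p \<Rightarrow> nat ^ 'p \<Rightarrow> bool) \<Rightarrow> nat ^ 'p \<Rightarrow> (nat ^ 'p) set set" where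
  "B_semigroups C le f =
     {S. C_semigroup C S \<and> S \<noteq> C \<and> Frob C le S = f \<and> S = S \<union> (C - cone_box C f)}"

definition alpha ::
  "(nat ^ 'p) set \<Rightarrow> (nat ^ 'p \<Rightarrow> nat ^ 'p \<Rightarrow> bool) \<Rightarrow> nat ^ 'p \<Rightarrow> (nat ^ 'p) set \<Rightarrow> nat ^ 'p"
  where
  "alpha C le f S =
     (if S \<inter> cone_box C f = {0} then f else min_wrt le ((S - {0}) \<inter> cone_box C f))"

definition special_gaps :: "(nat ^ 'p) set \<Rightarrow> (nat ^ 'p) set \<Rightarrow> (nat ^ 'p) set" where
  "special_gaps C S = {x \<in> gaps C S. (\<forall>s\<in>S - {0}. x + s \<in> S) \<and> x + x \<in> S}"

definition B_graph ::
  "(nat ^ 'p) set \<Rightarrow> (nat ^ 'p \<Rightarrow> nat ^ 'p \<Rightarrow> bool) \<Rightarrow> nat ^ 'p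
    \<Rightarrow> (nat ^ 'p) set pair_pre_digraph" where
  "B_graph C le f =
     \<lparr> pverts = B_semigroups C le f,
       parcs = {(S, T). S \<in> B_semigroups C le f \<and> T \<in> B_semigroups C le f \<and>
                        S \<noteq> T \<and> T = S - {alpha C le f S}} \<rparr>"

definition children :: "'a pair_pre_digraph \<Rightarrow> 'a \<Rightarrow> 'a set" where
  "children G T = {S. (S, T) \<in> parcs G}"

text \<open>
  Edges point towards the root. A \<open>pre_digraph.trail\<close> is a (possibly empty) directed walk,
  given as its list of arcs, whose arcs are pairwise distinct.
\<close>

definition tree_with_root :: "'a pair_pre_digraph \<Rightarrow> 'a \<Rightarrow> bool" where
  "tree_with_root G r \<longleftrightarrow>
     r \<in> pverts G \<and> (\<forall>v\<in>pverts G. \<exists>!p. pre_digraph.trail (with_proj G) v p r)"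

end

theory Submission
  imports Defs
begin

text \<open>
  Every element \<open>x\<close> of \<open>\<B>(f)\<close> satisfies \<open>x \<preceq> f\<close>, so removing the least non-zero element \<open>\<alpha>(S)\<close>
  from \<open>S \<inter> \<B>(f)\<close> preserves the Frobenius element \<open>f\<close>. It also preserves closedness under addition:
  if \<open>x + y = \<alpha>(S)\<close> with \<open>x, y \<in> S - {0}\<close>, then \<open>x\<close> lies in \<open>\<B>(f)\<close> and strictly below \<open>\<alpha>(S)\<close>. Hence
  each vertex other than the root has exactly one outgoing edge, and iterating exhausts the finite
  set \<open>S \<inter> \<B>(f)\<close>, which gives the unique path to the root.
\<close>

section \<open>Rooted trees from a strictly decreasing measure\<close>

text \<open>The arcs form a partial function that is undefined exactly at \<open>r\<close>.
  Iterating it from any vertex must stop because \<open>m\<close> decreases, and it can only stop at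
  \<open>r\<close>.\<close>

lemma tree_with_rootI:
  fixes G :: "'a pair_pre_digraph" and m :: "'a \<Rightarrow> nat"
  assumes r: "r \<in> pverts G"
    and wf: "\<And>v w. (v, w) \<in> parcs G \<Longrightarrow> v \<in> pverts G \<and> w \<in> pverts G"
    and unique: "\<And>v w w'. (v, w) \<in> parcs G \<Longrightarrow> (v, w') \<in> parcs G \<Longrightarrow> w = w'"
    and decreasing: "\<And>v w. (v, w) \<in> parcs G \<Longrightarrow> m w < m v"
    and out: "\<And>v. v \<in> pverts G \<Longrightarrow> v \<noteq> r \<Longrightarrow> \<exists>w. (v, w) \<in> parcs G"
    and sink: "\<And>w. (r, w) \<notin> parcs G"
  shows "tree_with_root G r"
proof -
  interpret wf_digraph "with_proj G"
    by unfold_locales (auto dest: wf)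
  \<comment> \<open>The bound on \<open>m\<close> at arc sources strengthens the induction: it shows
    that the arc prepended to the trail is not already in it, as \<open>trail\<close> demands
    distinct arcs.\<close>
  have "\<exists>p. trail v p r \<and> (\<forall>e\<in>set p. m (fst e) \<le> m v)" if "v \<in> pverts G" for v
    using that
  proof (induction "m v" arbitrary: v rule: less_induct)
    case less
    show ?case
    proof (cases "v = r")
      case True
      then show ?thesis
        using r by (intro exI[of _ "[]"]) (simp add: trail_Nil_iff)
    next
      case False
      then obtain w where w: "(v, w) \<in> parcs G"
        using out less.prems by blast
      then have "m w < m v" "w \<in> pverts G"
        using wf decreasing by blast+
      with less.hyps obtain p where p: "trail w p r" "\<forall>e\<in>set p. m (fst e) \<le> m w"
        by blast
      have "(v, w) \<notin> set p"
        using p(2) \<open>m w < m v\<close> by fastforce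
      then show ?thesis
        using p w \<open>m w < m v\<close> by (intro exI[of _ "(v, w) # p"]) (fastforce simp: trail_Cons_iff)
    qed
  qed
  \<comment> \<open>Both trails start with the only arc out of \<open>v\<close>, and neither can
    continue past \<open>r\<close>, so they agree arc by arc.\<close>
  moreover have "p = q" if "trail v p r" "trail v q r" for v p q
    using that
  proof (induction p arbitrary: v q)
    case Nil
    then show ?case
      using sink by (cases q) (auto simp: trail_simps)
  next
    case (Cons e p)
    from Cons.prems(1) have e: "e \<in> parcs G" "v = fst e" "trail (snd e) p r"
      by (auto simp: trail_Cons_iff)
    then have "v \<noteq> r"
      using sink[of "snd e"] by auto
    with Cons.prems(2) obtain e' q' where q: "q = e' # q'"
      by (cases q) (auto simp: trail_Nil_iff)
    with Cons.prems(2) have e': "e' \<in> parcs G" "v = fst e'" "trail (snd e') q' r"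
      by (auto simp: trail_Cons_iff)
    have "e = e'"
      using e e' unique[of v "snd e" "snd e'"] by (metis prod.collapse)
    then show ?case
      using Cons.IH e(3) e'(3) q by blast
  qed
  ultimately show ?thesis
    unfolding tree_with_root_def using r by blast
qed

section \<open>Affine integer cones and finiteness of boxes\<close>

lemma affine_integer_cone_add:
  assumes "affine_integer_cone C" "x \<in> C" "y \<in> C"
  shows "x + y \<in> C"
proof -
  obtain A where C: "C = {x. real_vec x \<in> nonneg_real_span A}"
    using assms(1) by (auto simp: affine_integer_cone_def)
  obtain c d where c: "real_vec x = (\<Sum>a\<in>A. c a *\<^sub>R real_vec a)" "\<forall>a\<in>A. 0 \<le> c a"
    and d: "real_vec y = (\<Sum>a\<in>A. d a *\<^sub>R real_vec a)" "\<forall>a\<in>A. 0 \<le> d a"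
    using assms(2,3) unfolding C nonneg_real_span_def by auto
  have "real_vec (x + y) = real_vec x + real_vec y"
    by (simp add: real_vec_def vec_eq_iff)
  also have "\<dots> = (\<Sum>a\<in>A. (c a + d a) *\<^sub>R real_vec a)"
    by (simp add: c d scaleR_add_left sum.distrib)
  finally have "real_vec (x + y) \<in> nonneg_real_span A"
    using c(2) d(2) by (auto simp: nonneg_real_span_def intro!: exI[of _ "\<lambda>a. c a + d a"])
  then show ?thesis
    using C by blast
qed

lemma affine_integer_cone_zero:
  assumes "affine_integer_cone C"
  shows "0 \<in> C"
proof -
  obtain A where C: "C = {x. real_vec x \<in> nonneg_real_span A}"
    using assms by (auto simp: affine_integer_cone_def)
  have "real_vec (0 :: nat ^ 'a) = (\<Sum>a\<in>A. 0 *\<^sub>R real_vec a)"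
    by (simp add: real_vec_def vec_eq_iff)
  then have "real_vec 0 \<in> nonneg_real_span A"
    unfolding nonneg_real_span_def by (auto intro!: exI[of _ "\<lambda>_. 0"])
  then show ?thesis
    using C by blast
qed

lemma finite_vec_atMost:
  fixes f :: "nat ^ 'p"
  shows "finite {x. \<forall>i. x $ i \<le> f $ i}"
proof (rule finite_subset)
  show "{x. \<forall>i. x $ i \<le> f $ i} \<subseteq> vec_lambda ` PiE UNIV (\<lambda>i. {..f $ i})"
  proof
    fix x assume "x \<in> {x. \<forall>i. x $ i \<le> f $ i}"
    then show "x \<in> vec_lambda ` PiE UNIV (\<lambda>i. {..f $ i})"
      by (intro image_eqI[of _ _ "vec_nth x"]) auto
  qed
  show "finite (vec_lambda ` PiE UNIV (\<lambda>i. {..f $ i}) :: (nat ^ 'p) set)"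
    by (intro finite_imageI finite_PiE) auto
qed

text \<open>Over the naturals, \<open>f = x + c\<close> bounds \<open>x\<close> by \<open>f\<close>
  in every coordinate.\<close>

lemma finite_cone_box: "finite (cone_box C f)"
  by (rule finite_subset[OF _ finite_vec_atMost[of f]]) (auto simp: cone_box_def cone_le_def)

section \<open>Extremal elements of total orders\<close>

lemma total_order_has_min:
  assumes "transp le" "totalp le" "reflp le" "finite X" "X \<noteq> {}"
  shows "\<exists>m\<in>X. \<forall>x\<in>X. le m x"
  using assms(4,5)
proof (induction rule: finite_ne_induct)
  case (singleton x)
  then show ?case
    using assms(3) by (auto dest: reflpD)
next
  case (insert x F)
  then obtain m where m: "m \<in> F" "\<forall>y\<in>F. le m y"
    by blast
  show ?case
  proof (cases "le m x")
    case True
    then show ?thesis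
      using m by auto
  next
    case False
    then have "le x m"
      using assms(2,3) by (metis reflpD totalpD)
    then show ?thesis
      using m assms(1,3) by (metis insert_iff reflpD transpD)
  qed
qed

lemma max_wrt_eqI:
  assumes "antisymp le" "m \<in> X" "\<And>x. x \<in> X \<Longrightarrow> le x m"
  shows "max_wrt le X = m"
  unfolding max_wrt_def using assms by (intro the_equality) (auto dest: antisympD)

lemma min_wrt_eqI:
  assumes "antisymp le" "m \<in> X" "\<And>x. x \<in> X \<Longrightarrow> le m x"
  shows "min_wrt le X = m"
  unfolding min_wrt_def using assms by (intro the_equality) (auto dest: antisympD)

section \<open>Semigroups containing the complement of the box\<close>

locale ordered_cone =
  fixes C :: "(nat ^ 'p) set" and le :: "nat ^ 'p \<Rightarrow> nat ^ 'p \<Rightarrow> bool" and f :: "nat ^ 'p"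
  assumes zero_in_C: "0 \<in> C"
    and add_in_C: "x \<in> C \<Longrightarrow> y \<in> C \<Longrightarrow> x + y \<in> C"
    and order: "additive_total_order le"
    and f_in_C: "f \<in> C"
    and f_nonzero: "f \<noteq> 0"
begin

lemma le_refl: "le x x"
  and le_antisym: "le x y \<Longrightarrow> le y x \<Longrightarrow> x = y"
  and le_trans: "le x y \<Longrightarrow> le y z \<Longrightarrow> le x z"
  and antisymp_le: "antisymp le"
  using order unfolding additive_total_order_def by (auto dest: reflpD antisympD transpD)

lemma le_add: "le x (x + y)"
proof -
  have "le (0 + x) (y + x)"
    using order unfolding additive_total_order_def by blast
  then show ?thesis
    by (simp add: add.commute)
qed

lemma le_if_in_box: "x \<in> cone_box C f \<Longrightarrow> le x f"
  using le_add by (auto simp: cone_box_def cone_le_def)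

lemma zero_in_box: "0 \<in> cone_box C f"
  using zero_in_C f_in_C by (auto simp: cone_box_def cone_le_def)

lemma f_in_box: "f \<in> cone_box C f"
  using zero_in_C f_in_C by (auto simp: cone_box_def cone_le_def)

text \<open>The box is downward closed for \<open>cone_le\<close>: if
  \<open>f = (x + y) + c\<close>, then \<open>y + c\<close> is the witness for
  \<open>x\<close>.\<close>

lemma in_box_if_add_in_box:
  assumes "x + y \<in> cone_box C f" "x \<in> C" "y \<in> C"
  shows "x \<in> cone_box C f"
  using assms add_in_C by (auto simp: cone_box_def cone_le_def add.assoc)

text \<open>Once all gaps lie in the box, which is finite with greatest element \<open>f\<close>,
  finiteness of the gaps is automatic and the Frobenius condition reduces to \<open>f\<close> being
  a gap.\<close>

lemma B_semigroups_iff: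
  "S \<in> B_semigroups C le f \<longleftrightarrow>
     S \<subseteq> C \<and> 0 \<in> S \<and> (\<forall>x\<in>S. \<forall>y\<in>S. x + y \<in> S) \<and> f \<notin> S \<and> C - cone_box C f \<subseteq> S"
    (is "_ \<longleftrightarrow> ?R")
proof
  assume "S \<in> B_semigroups C le f"
  then have S: "S \<subseteq> C" "0 \<in> S" "\<forall>x\<in>S. \<forall>y\<in>S. x + y \<in> S" "S \<noteq> C"
    "max_wrt le (gaps C S) = f" "S = S \<union> (C - cone_box C f)" "finite (gaps C S)"
    by (auto simp: B_semigroups_def C_semigroup_def Frob_def)
  \<comment> \<open>The greatest gap is obtained as a least element for the converse order.\<close>
  have "transp (\<lambda>x y. le y x)" "totalp (\<lambda>x y. le y x)" "reflp (\<lambda>x y. le y x)"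
    using order unfolding additive_total_order_def transp_def totalp_on_def reflp_def by blast+
  moreover have "gaps C S \<noteq> {}"
    using S(1,4) by (auto simp: gaps_def)
  ultimately obtain m where m: "m \<in> gaps C S" "\<forall>x\<in>gaps C S. le x m"
    using S(7) total_order_has_min by meson
  then have "max_wrt le (gaps C S) = m"
    using antisymp_le by (intro max_wrt_eqI) auto
  with S(5) m(1) have "f \<notin> S"
    by (simp add: gaps_def)
  with S show ?R
    by blast
next
  assume R: ?R
  have gaps: "gaps C S \<subseteq> cone_box C f"
    using R by (auto simp: gaps_def)
  have "max_wrt le (gaps C S) = f"
  proof (rule max_wrt_eqI[OF antisymp_le])
    show "f \<in> gaps C S"
      using R f_in_C by (simp add: gaps_def)
    show "le x f" if "x \<in> gaps C S" for x
      using that gaps le_if_in_box by blast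
  qed
  moreover have "finite (gaps C S)"
    using gaps finite_cone_box by (rule finite_subset)
  moreover have "S \<noteq> C"
    using R f_in_C by blast
  ultimately show "S \<in> B_semigroups C le f"
    using R by (auto simp: B_semigroups_def C_semigroup_def Frob_def)
qed

text \<open>The least member of \<open>B_semigroups C le f\<close> under inclusion.\<close>

definition "B_root = (C - cone_box C f) \<union> {0}"

lemma root_in_B_semigroups: "B_root \<in> B_semigroups C le f"
proof -
  have "x + y \<in> B_root" if "x \<in> B_root" "y \<in> B_root" for x y
  proof (cases "x = 0 \<or> y = 0")
    case True
    then show ?thesis
      using that by auto
  next
    case False
    then have "x \<in> C" "y \<in> C" "x \<notin> cone_box C f"
      using that by (auto simp: B_root_def)
    then show ?thesis
      using add_in_C in_box_if_add_in_box unfolding B_root_def by blast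
  qed
  then show ?thesis
    using zero_in_C f_nonzero f_in_box unfolding B_semigroups_iff by (auto simp: B_root_def)
qed

text \<open>All vertices agree outside the box, so each is determined by its trace on the box. This
  also decides which branch of \<open>alpha\<close> applies.\<close>

lemma eq_root_iff:
  assumes "S \<in> B_semigroups C le f"
  shows "S = B_root \<longleftrightarrow> S \<inter> cone_box C f = {0}"
  using assms zero_in_box unfolding B_semigroups_iff B_root_def by blast

section \<open>The least non-zero element in the box\<close>

lemma alpha_eqI:
  assumes "x \<in> S" "x \<noteq> 0" "x \<in> cone_box C f"
    and "\<And>y. y \<in> S \<Longrightarrow> y \<noteq> 0 \<Longrightarrow> y \<in> cone_box C f \<Longrightarrow> le x y"
  shows "alpha C le f S = x"
proof -
  have "min_wrt le ((S - {0}) \<inter> cone_box C f) = x"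
    using assms by (intro min_wrt_eqI antisymp_le) auto
  then show ?thesis
    using assms(1-3) by (auto simp: alpha_def)
qed

text \<open>With this default value, the condition x \<prec> \<alpha>(T) at the root excludes only
  \<open>f\<close> among the elements of the box.\<close>

lemma alpha_root: "alpha C le f B_root = f"
  using eq_root_iff[OF root_in_B_semigroups] by (simp add: alpha_def)

lemma alpha_props:
  assumes "S \<in> B_semigroups C le f" "S \<noteq> B_root"
  shows "alpha C le f S \<in> S" "alpha C le f S \<noteq> 0" "alpha C le f S \<in> cone_box C f"
    and "y \<in> S \<Longrightarrow> y \<noteq> 0 \<Longrightarrow> y \<in> cone_box C f \<Longrightarrow> le (alpha C le f S) y"
proof -
  have "(S - {0}) \<inter> cone_box C f \<noteq> {}"
    using assms eq_root_iff[OF assms(1)] zero_in_box by (auto simp: B_semigroups_iff)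
  moreover have "transp le" "totalp le" "reflp le" "finite ((S - {0}) \<inter> cone_box C f)"
    using order finite_cone_box unfolding additive_total_order_def by blast+
  ultimately obtain m where m: "m \<in> (S - {0}) \<inter> cone_box C f"
    "\<forall>y\<in>(S - {0}) \<inter> cone_box C f. le m y"
    using total_order_has_min by meson
  then have "alpha C le f S = m"
    by (intro alpha_eqI) auto
  with m show "alpha C le f S \<in> S" "alpha C le f S \<noteq> 0" "alpha C le f S \<in> cone_box C f"
    and "y \<in> S \<Longrightarrow> y \<noteq> 0 \<Longrightarrow> y \<in> cone_box C f \<Longrightarrow> le (alpha C le f S) y"
    by auto
qed

lemma alpha_le:
  assumes "S \<in> B_semigroups C le f"
  shows "le (alpha C le f S) f"
  using alpha_props(3)[OF assms] alpha_root le_refl le_if_in_box by metis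

lemma remove_alpha_in_B_semigroups:
  assumes S: "S \<in> B_semigroups C le f" and "S \<noteq> B_root"
  shows "S - {alpha C le f S} \<in> B_semigroups C le f"
proof -
  note a = alpha_props[OF assms]
  have "x + y \<noteq> alpha C le f S" if "x \<in> S - {alpha C le f S}" "y \<in> S - {alpha C le f S}" for x y
  proof
    assume eq: "x + y = alpha C le f S"
    then have "x \<noteq> 0"
      using that by auto
    moreover have "x \<in> cone_box C f"
      using eq a(3) that S in_box_if_add_in_box[of x y] unfolding B_semigroups_iff by auto
    ultimately have "le (alpha C le f S) x"
      using a(4) that by blast
    moreover have "le x (alpha C le f S)"
      using le_add eq by metis
    ultimately show False
      using le_antisym that by blast
  qed
  then show ?thesis
    using S a(2,3) unfolding B_semigroups_iff by auto
qed

section \<open>Arcs and the tree structure\<close>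

lemma B_graph_arc_iff:
  "(S, T) \<in> parcs (B_graph C le f) \<longleftrightarrow>
     S \<in> B_semigroups C le f \<and> S \<noteq> B_root \<and> T = S - {alpha C le f S}"
proof (cases "S \<in> B_semigroups C le f \<and> S \<noteq> B_root")
  case True
  then show ?thesis
    using remove_alpha_in_B_semigroups[of S] alpha_props(1)[of S] by (auto simp: B_graph_def)
next
  case False
  \<comment> \<open>At the root the default value \<open>f\<close> is a gap, so removing it changes
    nothing and no arc leaves the root.\<close>
  have "B_root - {alpha C le f B_root} = B_root"
    using alpha_root f_in_box f_nonzero by (auto simp: B_root_def)
  then show ?thesis
    using False unfolding B_graph_def by auto
qed

lemma tree_with_root_B_graph: "tree_with_root (B_graph C le f) B_root"
proof (rule tree_with_rootI[where m = "\<lambda>S. card (S \<inter> cone_box C f)"])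
  show "B_root \<in> pverts (B_graph C le f)"
    by (simp add: B_graph_def root_in_B_semigroups)
  show "S \<in> pverts (B_graph C le f) \<and> T \<in> pverts (B_graph C le f)"
    if "(S, T) \<in> parcs (B_graph C le f)" for S T
    using that by (auto simp: B_graph_def)
  show "card (T \<inter> cone_box C f) < card (S \<inter> cone_box C f)"
    if "(S, T) \<in> parcs (B_graph C le f)" for S T
  proof (rule psubset_card_mono)
    show "T \<inter> cone_box C f \<subset> S \<inter> cone_box C f"
      using that alpha_props(1,3)[of S] unfolding B_graph_arc_iff by auto
  qed (simp add: finite_cone_box)
  show "\<exists>T. (S, T) \<in> parcs (B_graph C le f)"
    if "S \<in> pverts (B_graph C le f)" "S \<noteq> B_root" for S
    using that by (simp add: B_graph_arc_iff) (simp add: B_graph_def)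
qed (simp_all add: B_graph_arc_iff)

section \<open>Children and special gaps\<close>

lemma child_in_special_gaps:
  assumes S: "S \<in> B_semigroups C le f" "S \<noteq> B_root"
    and T: "T = S - {alpha C le f S}"
  shows "alpha C le f S \<in> special_gaps C T"
    and "le (alpha C le f S) (alpha C le f T)" and "alpha C le f S \<noteq> alpha C le f T"
proof -
  note a = alpha_props[OF S]
  let ?x = "alpha C le f S"
  have S': "S \<subseteq> C" "\<And>s t. s \<in> S \<Longrightarrow> t \<in> S \<Longrightarrow> s + t \<in> S" "f \<notin> S"
    using S(1) unfolding B_semigroups_iff by blast+
  \<comment> \<open>As \<open>s\<close> is non-zero, the sum differs from \<open>?x\<close> and
    survives its removal. The case \<open>s = ?x\<close> gives the doubling condition.\<close>
  have "?x + s \<in> T" if "s \<in> S" "s \<noteq> 0" for s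
    using S'(2)[OF a(1) that(1)] that(2) by (simp add: T)
  then show "?x \<in> special_gaps C T"
    using a(1,2) S'(1) by (auto simp: special_gaps_def gaps_def T)
  \<comment> \<open>At the root the bound is \<open>f\<close>, which is not in \<open>S\<close>.
    Otherwise \<open>alpha C le f T\<close> is itself a non-zero element of \<open>S\<close> in the
    box, distinct from the removed minimum \<open>?x\<close>.\<close>
  have "le ?x (alpha C le f T) \<and> ?x \<noteq> alpha C le f T"
  proof (cases "T = B_root")
    case True
    have "?x \<noteq> f"
      using a(1) S'(3) by metis
    then show ?thesis
      using True alpha_root alpha_le[OF S(1)] by simp
  next
    case False
    have "T \<in> B_semigroups C le f"
      unfolding T using S by (rule remove_alpha_in_B_semigroups)
    note b = alpha_props(1-3)[OF this False]
    have "alpha C le f T \<in> S" "alpha C le f T \<noteq> ?x"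
      using b(1) unfolding T by blast+
    then show ?thesis
      using a(4)[OF _ b(2,3)] by simp
  qed
  then show "le ?x (alpha C le f T)" "?x \<noteq> alpha C le f T"
    by auto
qed

text \<open>Being a special gap provides the sums \<open>x + s\<close> and \<open>x + x\<close>
  needed for closure. Lying strictly below \<alpha>(T) keeps \<open>f\<close> a gap and makes
  \<open>x\<close> the new minimum.\<close>

lemma special_gap_child:
  assumes T: "T \<in> B_semigroups C le f" and x: "x \<in> special_gaps C T"
    and less: "le x (alpha C le f T)" "x \<noteq> alpha C le f T"
  shows "T \<union> {x} \<in> B_semigroups C le f" "T \<union> {x} \<noteq> B_root" "alpha C le f (T \<union> {x}) = x"
proof -
  have T': "T \<subseteq> C" "0 \<in> T" "\<And>s t. s \<in> T \<Longrightarrow> t \<in> T \<Longrightarrow> s + t \<in> T" "f \<notin> T" "C - cone_box C f \<subseteq> T"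
    using T unfolding B_semigroups_iff by auto
  have x': "x \<in> C" "x \<notin> T" "x + x \<in> T" "\<And>s. s \<in> T \<Longrightarrow> s \<noteq> 0 \<Longrightarrow> x + s \<in> T"
    using x by (auto simp: special_gaps_def gaps_def)
  \<comment> \<open>\<open>T\<close> contains \<open>0\<close> and all of \<open>C\<close> outside
    the box, so a gap of \<open>T\<close> is non-zero and lies in the box.\<close>
  have box: "x \<in> cone_box C f" and "x \<noteq> 0"
    using x' T' by auto
  have "x \<noteq> f"
    using less alpha_le[OF T] le_antisym by blast
  moreover have "s + t \<in> T \<union> {x}" if "s \<in> T \<union> {x}" "t \<in> T \<union> {x}" for s t
  proof (cases "s = 0 \<or> t = 0")
    case True
    then show ?thesis
      using that by auto
  next
    case False
    then show ?thesis
      using that T'(3)[of s t] x'(3) x'(4)[of s] x'(4)[of t] by (auto simp: add.commute)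
  qed
  ultimately show "T \<union> {x} \<in> B_semigroups C le f"
    using T'(1,2,4,5) x'(1) unfolding B_semigroups_iff by blast
  show "T \<union> {x} \<noteq> B_root"
    using box \<open>x \<noteq> 0\<close> by (auto simp: B_root_def)
  show "alpha C le f (T \<union> {x}) = x"
  proof (rule alpha_eqI)
    show "le x y" if "y \<in> T \<union> {x}" "y \<noteq> 0" "y \<in> cone_box C f" for y
    proof (cases "y = x")
      case True
      then show ?thesis
        by (simp add: le_refl)
    next
      case False
      then have "y \<in> T"
        using that by blast
      \<comment> \<open>The root has no non-zero element in the box, so here \<alpha>(T) is a true
        minimum and not the default value.\<close>
      then have "T \<noteq> B_root"
        using that by (auto simp: B_root_def)
      then show ?thesis
        using alpha_props(4)[OF T] \<open>y \<in> T\<close> that less(1) le_trans by blast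
    qed
  qed (use box \<open>x \<noteq> 0\<close> in auto)
qed

lemma children_B_graph:
  assumes T: "T \<in> B_semigroups C le f"
  shows "children (B_graph C le f) T =
    {T \<union> {x} | x. x \<in> special_gaps C T \<and> le x (alpha C le f T) \<and> x \<noteq> alpha C le f T}"
    (is "_ = ?R")
proof (rule set_eqI)
  fix S
  show "S \<in> children (B_graph C le f) T \<longleftrightarrow> S \<in> ?R"
  proof
    assume "S \<in> children (B_graph C le f) T"
    then have S: "S \<in> B_semigroups C le f" "S \<noteq> B_root" "T = S - {alpha C le f S}"
      by (auto simp: children_def B_graph_arc_iff)
    then have "S = T \<union> {alpha C le f S}"
      using alpha_props(1)[OF S(1,2)] by auto
    then show "S \<in> ?R"
      using child_in_special_gaps[OF S] by blast
  next
    assume "S \<in> ?R"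
    then obtain x where S: "S = T \<union> {x}" and x: "x \<in> special_gaps C T"
      and less: "le x (alpha C le f T)" "x \<noteq> alpha C le f T"
      by blast
    \<comment> \<open>This ensures that removing \<open>x\<close>, the \<open>alpha\<close> of the
      enlarged set, gives back exactly \<open>T\<close>.\<close>
    have "x \<notin> T"
      using x by (auto simp: special_gaps_def gaps_def)
    then have "T \<union> {x} - {x} = T"
      by blast
    then show "S \<in> children (B_graph C le f) T"
      using special_gap_child[OF T x less] unfolding S children_def
      by (simp add: B_graph_arc_iff del: Un_insert_right)
  qed
qed

end

theorem theorem12:
  fixes C :: "(nat ^ 'p) set" and le :: "nat ^ 'p \<Rightarrow> nat ^ 'p \<Rightarrow> bool" and f :: "nat ^ 'p"
  assumes "affine_integer_cone C"
    and "additive_total_order le"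
    and "f \<in> C - {0}"
  shows "tree_with_root (B_graph C le f) ((C - cone_box C f) \<union> {0}) \<and>
    (\<forall>T \<in> B_semigroups C le f.
       children (B_graph C le f) T =
         {T \<union> {x} | x. x \<in> special_gaps C T \<and> le x (alpha C le f T) \<and> x \<noteq> alpha C le f T})"
proof -
  interpret ordered_cone C le f
    using assms affine_integer_cone_zero affine_integer_cone_add by unfold_locales auto
  show ?thesis
    using tree_with_root_B_graph children_B_graph unfolding B_root_def by blast
qed

end
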